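(* Let $G=(V,E)$ be a non-complete connected (simple, undirected, locally finite) graph with minimum degree $\delta(G)$ and connectivity $k(G)$. Suppose that any two adjacent vertices have at most $\alpha$ common neighbors, and any two vertices at distance $2$ have at most $\beta$ common neighbors. Then $$k(G)\geq \left(2\kappa_{LLY}(G)+1\right)\delta(G)-2\alpha-\beta-2.$$
   Context: The connectivity $k(G)$ of a non-complete graph is the minimum number of vertices whose removal disconnects $G$. $d(x,y)$ is the graph distance and $d_x$ the degree of $x$. For $p\in[0,1]$ and a vertex $x$, $\mu_x^p$ is the probability measure with $\mu_x^p(x)=p$, $\mu_x^p(y)=\frac{1-p}{d_x}$ if $y$ is adjacent to $x$, and $0$ otherwise. For probability measures $\mu_1,\mu_2$ on $V$, $W(\mu_1,\mu_2)=\inf_\pi\sum_{x,y}d(x,y)\pi(x,y)$ over all $\pi:V\times V\to[0,1]$ with marginals $\mu_1$ and $\mu_2$. For distinct vertices $x,y$, $\kappa_p(x,y)=1-\frac{W(\mu_x^p,\mu_y^p)}{d(x,y)}$ and $\kappa_{LLY}(x,y)=\lim_{p\to1}\frac{\kappa_p(x,y)}{1-p}$. $\kappa_{LLY}(G)=\inf\{\kappa_{LLY}(x,y): x,y \text{ adjacent}\}$. *)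

theory Defs
  imports "HOL-Analysis.Analysis" "Graph_Theory.Graph_Theory"
begin

text \<open>
  A simple undirected graph, possibly infinite, is a loop-free symmetric pair digraph: each
  undirected edge xy is represented by the two arcs (x, y) and (y, x).
\<close>

locale locally_finite_graph = pair_bidirected_digraph G for G :: "'a pair_pre_digraph" +
  assumes locally_finite: "v \<in> pverts G \<Longrightarrow> finite (out_arcs (with_proj G) v)"

definition adjacent :: "'a pair_pre_digraph \<Rightarrow> 'a \<Rightarrow> 'a \<Rightarrow> bool" where
  "adjacent G x y \<longleftrightarrow> (x, y) \<in> parcs G"

definition complete_graph :: "'a pair_pre_digraph \<Rightarrow> bool" where
  "complete_graph G \<longleftrightarrow> (\<forall>x\<in>pverts G. \<forall>y\<in>pverts G. x \<noteq> y \<longrightarrow> adjacent G x y)"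

definition degree :: "'a pair_pre_digraph \<Rightarrow> 'a \<Rightarrow> nat" where
  "degree G x = out_degree (with_proj G) x"

definition min_degree :: "'a pair_pre_digraph \<Rightarrow> nat" where
  "min_degree G = (INF x\<in>pverts G. degree G x)"

definition common_neighbors :: "'a pair_pre_digraph \<Rightarrow> 'a \<Rightarrow> 'a \<Rightarrow> 'a set" where
  "common_neighbors G x y = {z \<in> pverts G. adjacent G x z \<and> adjacent G y z}"

definition graph_dist :: "'a pair_pre_digraph \<Rightarrow> 'a \<Rightarrow> 'a \<Rightarrow> nat" where
  "graph_dist G x y = (LEAST n. \<exists>p. pre_digraph.awalk (with_proj G) x p y \<and> length p = n)"

text \<open>
  Digraph_Component.connected is false for the graph without vertices, so the remaining vertex set is
  required to be nonempty.
\<close>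

definition disconnecting_set :: "'a pair_pre_digraph \<Rightarrow> 'a set \<Rightarrow> bool" where
  "disconnecting_set G S \<longleftrightarrow> S \<subseteq> pverts G \<and> pverts G - S \<noteq> {} \<and>
     \<not> Digraph_Component.connected (with_proj G \<restriction> (pverts G - S))"

text \<open>
  A non-complete locally finite graph always has a finite disconnecting set (the neighborhood
  of a vertex that is not adjacent to all others), so the minimum below is attained.
\<close>

definition connectivity :: "'a pair_pre_digraph \<Rightarrow> nat" where
  "connectivity G = (LEAST n. \<exists>S. finite S \<and> card S = n \<and> disconnecting_set G S)"

definition lazy_walk :: "'a pair_pre_digraph \<Rightarrow> real \<Rightarrow> 'a \<Rightarrow> 'a \<Rightarrow> real" where
  "lazy_walk G p x y =
     (if y = x then p else if adjacent G x y then (1 - p) / real (degree G x) else 0)"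

definition coupling ::
    "'a set \<Rightarrow> ('a \<Rightarrow> real) \<Rightarrow> ('a \<Rightarrow> real) \<Rightarrow> ('a \<Rightarrow> 'a \<Rightarrow> real) \<Rightarrow> bool" where
  "coupling V \<mu>1 \<mu>2 \<pi> \<longleftrightarrow>
     (\<forall>x\<in>V. \<forall>y\<in>V. 0 \<le> \<pi> x y \<and> \<pi> x y \<le> 1) \<and>
     (\<forall>x\<in>V. ((\<lambda>y. \<pi> x y) has_sum \<mu>1 x) V) \<and>
     (\<forall>y\<in>V. ((\<lambda>x. \<pi> x y) has_sum \<mu>2 y) V)"

text \<open>
  Couplings of infinite cost do not contribute to the infimum. For finitely supported
  measures, such as those of the lazy random walk, every coupling has finite cost.
\<close>

definition wasserstein :: "'a pair_pre_digraph \<Rightarrow> ('a \<Rightarrow> real) \<Rightarrow> ('a \<Rightarrow> real) \<Rightarrow> real" where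
  "wasserstein G \<mu>1 \<mu>2 =
     Inf {c. \<exists>\<pi>. coupling (pverts G) \<mu>1 \<mu>2 \<pi> \<and>
       ((\<lambda>(x, y). real (graph_dist G x y) * \<pi> x y) has_sum c) (pverts G \<times> pverts G)}"

definition kappa :: "'a pair_pre_digraph \<Rightarrow> real \<Rightarrow> 'a \<Rightarrow> 'a \<Rightarrow> real" where
  "kappa G p x y =
     1 - wasserstein G (lazy_walk G p x) (lazy_walk G p y) / real (graph_dist G x y)"

text \<open>The limit is one-sided because idleness parameters lie in the unit interval.\<close>

definition kappa_LLY :: "'a pair_pre_digraph \<Rightarrow> 'a \<Rightarrow> 'a \<Rightarrow> real" where
  "kappa_LLY G x y = Lim (at_left 1) (\<lambda>p. kappa G p x y / (1 - p))"

definition kappa_LLY_graph :: "'a pair_pre_digraph \<Rightarrow> real" where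
  "kappa_LLY_graph G = Inf {kappa_LLY G x y | x y. adjacent G x y}"

end

theory Submission
  imports Defs
begin

text \<open>
  For any function \<open>f\<close> that changes by at most 1 along edges and any edge \<open>xy\<close> with \<open>f(y) - f(x) = 1\<close>,
  testing the transport problem against \<open>f\<close> bounds the curvature of \<open>xy\<close> by \<open>\<Delta>f(x) - \<Delta>f(y)\<close>. Let \<open>W\<close> be a
  minimum vertex cut separating \<open>X\<close> from \<open>Y\<close>. A vertex \<open>w\<close> of \<open>W\<close> has neighbors \<open>x\<close> in \<open>X\<close> and \<open>y\<close> in \<open>Y\<close>.
  For the edge \<open>xw\<close>, take \<open>f\<close> to be 0 on \<open>Y\<close> and at \<open>w\<close>, -1 on the rest of \<open>W\<close> and on the neighbors
  of \<open>w\<close> in \<open>X\<close>, and -2 on the rest of \<open>X\<close>; for the edge \<open>yw\<close>, exchange the roles of \<open>X\<close> and \<open>Y\<close>. Adding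
  the two bounds leaves a count of vertices of \<open>W\<close>, which is settled vertex by vertex: for truth
  values \<open>a, b, c\<close> one has \<open>a + b + c \<le> 1 + ab + ac + bc\<close>.

  The limit defining the curvature of an edge exists because \<open>\<kappa>\<^sub>p/(1 - p)\<close> is increasing in \<open>p\<close> (convexity of the
  transport cost) and bounded. The product coupling bounds it below by -2 on every edge, so the
  infimum over all edges is not a junk value, even for infinite graphs.
\<close>

section \<open>Distances\<close>

definition neighbors :: "'a pair_pre_digraph \<Rightarrow> 'a \<Rightarrow> 'a set" where
  "neighbors G x = {y. adjacent G x y}"

lemma in_neighbors [simp]: "y \<in> neighbors G x \<longleftrightarrow> adjacent G x y"
  by (simp add: neighbors_def)

context locally_finite_graph
begin

lemma adjacent_sym: "adjacent G x y \<Longrightarrow> adjacent G y x"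
  using graph_symmetric by (auto simp: adjacent_def)

lemma adjacent_neq: "adjacent G x y \<Longrightarrow> x \<noteq> y"
  using pair_no_loops[of "(x, y)"] by (simp add: adjacent_def)

lemma adjacent_in_pverts:
  assumes "adjacent G x y"
  shows "x \<in> pverts G" "y \<in> pverts G"
  using assms in_arcsD1 in_arcsD2 by (auto simp: adjacent_def)

lemma out_arcs_eq: "out_arcs (with_proj G) x = Pair x ` neighbors G x"
  by (auto simp: out_arcs_def adjacent_def)

lemma finite_neighbors: "finite (neighbors G x)"
proof (cases "x \<in> pverts G")
  case True
  then show ?thesis
    using locally_finite[of x] by (simp add: out_arcs_eq finite_image_iff inj_on_def)
next
  case False
  then have "neighbors G x = {}"
    using adjacent_in_pverts by auto
  then show ?thesis by simp
qed

lemma degree_eq: "degree G x = card (neighbors G x)"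
  by (simp add: degree_def out_degree_def out_arcs_eq card_image inj_on_def)

lemma degree_pos: "adjacent G x y \<Longrightarrow> degree G x > 0"
  using finite_neighbors[of x] by (auto simp: degree_eq card_gt_0_iff)

lemma min_degree_le: "x \<in> pverts G \<Longrightarrow> min_degree G \<le> degree G x"
  unfolding min_degree_def by (rule cINF_lower) auto

lemma common_neighbors_eq: "common_neighbors G x y = neighbors G x \<inter> neighbors G y"
  using adjacent_in_pverts by (auto simp: common_neighbors_def)

lemma graph_dist_le: "awalk x p y \<Longrightarrow> graph_dist G x y \<le> length p"
  unfolding graph_dist_def by (rule Least_le) auto

end

section \<open>Shortest walks and Lipschitz functions in a connected graph\<close>

locale connected_locally_finite_graph = locally_finite_graph +
  assumes connected: "Digraph_Component.connected (with_proj G)"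
begin

lemma ex_shortest_awalk:
  assumes "x \<in> pverts G" "y \<in> pverts G"
  obtains p where "awalk x p y" "length p = graph_dist G x y"
proof -
  have "strongly_connected (with_proj G)"
    using connected pair_sym_arcs symmetric_connected_imp_strongly_connected by blast
  then have "x \<rightarrow>\<^sup>*\<^bsub>with_proj G\<^esub> y"
    using assms by (auto simp: strongly_connected_def)
  then have "\<exists>n p. awalk x p y \<and> length p = n"
    by (simp add: reachable_awalk)
  then have "\<exists>p. awalk x p y \<and> length p = graph_dist G x y"
    unfolding graph_dist_def by (rule LeastI_ex)
  then show ?thesis using that by blast
qed

lemma graph_dist_refl: "x \<in> pverts G \<Longrightarrow> graph_dist G x x = 0"
  using graph_dist_le[of x "[]" x] by (simp add: awalk_Nil_iff)

lemma graph_dist_triangle: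
  assumes "x \<in> pverts G" "y \<in> pverts G" "z \<in> pverts G"
  shows "graph_dist G x z \<le> graph_dist G x y + graph_dist G y z"
proof -
  obtain p where "awalk x p y" "length p = graph_dist G x y"
    using ex_shortest_awalk[OF assms(1,2)] .
  moreover obtain q where "awalk y q z" "length q = graph_dist G y z"
    using ex_shortest_awalk[OF assms(2,3)] .
  ultimately show ?thesis
    using graph_dist_le[of x "p @ q" z] by auto
qed

text \<open>The increments of \<open>f\<close> telescope along the walk. As adjacency is symmetric,
  the one-sided hypothesis bounds the change of \<open>f\<close> along an edge in both
  directions.\<close>

lemma lipschitz_awalk:
  fixes f :: "'a \<Rightarrow> real"
  assumes lip: "\<And>u v. adjacent G u v \<Longrightarrow> f v - f u \<le> 1"
  assumes "awalk x p y"
  shows "f y - f x \<le> real (length p)"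
  using assms(2)
proof (induction p arbitrary: x)
  case Nil
  then show ?case by (simp add: awalk_Nil_iff)
next
  case (Cons e p)
  then have "e \<in> parcs G" "x = fst e" and p: "awalk (snd e) p y"
    by (auto simp: awalk_Cons_iff)
  then have "f (snd e) - f x \<le> 1"
    using lip by (simp add: adjacent_def)
  with Cons.IH[OF p] show ?case by simp
qed

lemma lipschitz_graph_dist:
  fixes f :: "'a \<Rightarrow> real"
  assumes "\<And>u v. adjacent G u v \<Longrightarrow> f v - f u \<le> 1"
  assumes "x \<in> pverts G" "y \<in> pverts G"
  shows "f y - f x \<le> real (graph_dist G x y)"
proof -
  obtain p where "awalk x p y" "length p = graph_dist G x y"
    using ex_shortest_awalk[OF assms(2,3)] .
  then show ?thesis
    using lipschitz_awalk[of f x p y] assms(1) by simp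
qed

lemma graph_dist_adjacent:
  assumes "adjacent G x y"
  shows "graph_dist G x y = 1"
proof -
  have "graph_dist G x y \<le> 1"
    using graph_dist_le[of x "[(x, y)]" y] assms adjacent_in_pverts
    by (auto simp: awalk_def adjacent_def)
  moreover have "graph_dist G x y \<noteq> 0"
  proof
    assume "graph_dist G x y = 0"
    moreover obtain p where "awalk x p y" "length p = graph_dist G x y"
      using ex_shortest_awalk[OF adjacent_in_pverts[OF assms]] .
    ultimately have "awalk x [] y" by simp
    then show False
      using adjacent_neq[OF assms] by (simp add: awalk_Nil_iff)
  qed
  ultimately show ?thesis by simp
qed

lemma graph_dist_eq_2:
  assumes "adjacent G x w" "adjacent G w y" "x \<noteq> y" "\<not> adjacent G x y"
  shows "graph_dist G x y = 2"
proof -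
  have V: "x \<in> pverts G" "y \<in> pverts G"
    using assms adjacent_in_pverts by blast+
  have "graph_dist G x y \<le> 2"
    using graph_dist_le[of x "[(x, w), (w, y)]" y] assms V
    by (auto simp: awalk_def adjacent_def)
  moreover obtain p where p: "awalk x p y" "length p = graph_dist G x y"
    using ex_shortest_awalk[OF V] .
  have "length p \<noteq> 0"
    using p(1) assms(3) by (auto simp: awalk_Nil_iff)
  moreover have "length p \<noteq> 1"
    using p(1) assms(4) by (auto simp: awalk_Cons_iff awalk_Nil_iff adjacent_def length_Suc_conv)
  ultimately show ?thesis using p by linarith
qed

end

section \<open>Vertex cuts\<close>

text \<open>The sides need not be connected: each is a nonempty union of components of the graph
  without \<open>W\<close>. This form replaces reachability by a condition on single edges.\<close>

definition separation :: "'a pair_pre_digraph \<Rightarrow> 'a set \<Rightarrow> 'a set \<Rightarrow> 'a set \<Rightarrow> bool" where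
  "separation G W X Y \<longleftrightarrow> X \<noteq> {} \<and> Y \<noteq> {} \<and> X \<inter> Y = {} \<and> X \<union> Y = pverts G - W \<and>
    (\<forall>a\<in>X. \<forall>b\<in>Y. \<not> adjacent G a b)"

context locally_finite_graph
begin

lemma separation_sym: "separation G W X Y \<Longrightarrow> separation G W Y X"
  unfolding separation_def using adjacent_sym by blast

text \<open>\<open>Digraph_Component.connected\<close> means strong connectedness of the symmetric
  closure. A set that no edge leaves within \<open>U\<close> is closed under each step there, hence
  under reachability.\<close>

lemma reachable_mk_symmetric_closed:
  assumes "u \<rightarrow>\<^sup>*\<^bsub>with_proj (mk_symmetric (with_proj G \<restriction> U))\<^esub> v" "u \<in> X"
    and "\<And>a b. a \<in> X \<Longrightarrow> b \<in> U - X \<Longrightarrow> \<not> adjacent G a b"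
  shows "v \<in> X"
  using assms(1) unfolding reachable_def
proof (induction rule: rtrancl_on_induct)
  case base
  then show ?case using assms(2) by simp
next
  case (step y z)
  then have "adjacent G y z \<or> adjacent G z y" "z \<in> U"
    by (auto simp: parcs_mk_symmetric adjacent_def)
  then have "adjacent G y z" "z \<in> U"
    using adjacent_sym by auto
  then show ?case using assms(3) step.IH by blast
qed

lemma disconnecting_set_iff:
  "disconnecting_set G S \<longleftrightarrow> S \<subseteq> pverts G \<and> (\<exists>X Y. separation G S X Y)"
  (is "_ \<longleftrightarrow> _ \<and> ?P")
proof -
  define U where "U = pverts G - S"
  define M where "M = with_proj (mk_symmetric (with_proj G \<restriction> U))"
  have conn: "Digraph_Component.connected (with_proj G \<restriction> U) \<longleftrightarrow>
      U \<noteq> {} \<and> (\<forall>u\<in>U. \<forall>v\<in>U. u \<rightarrow>\<^sup>*\<^bsub>M\<^esub> v)"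
    by (simp add: Digraph_Component.connected_def strongly_connected_def M_def)
  have "?P \<longleftrightarrow> U \<noteq> {} \<and> (\<exists>u\<in>U. \<exists>v\<in>U. \<not> u \<rightarrow>\<^sup>*\<^bsub>M\<^esub> v)"
  proof
    assume ?P
    then obtain X Y where "separation G S X Y" by blast
    then have XY: "X \<noteq> {}" "Y \<noteq> {}" "X \<inter> Y = {}" "X \<union> Y = U"
      and sep: "\<And>a b. a \<in> X \<Longrightarrow> b \<in> Y \<Longrightarrow> \<not> adjacent G a b"
      by (simp_all add: separation_def U_def)
    obtain u v where uv: "u \<in> X" "v \<in> Y" using XY by blast
    have "U - X = Y" using XY by blast
    then have "\<not> u \<rightarrow>\<^sup>*\<^bsub>M\<^esub> v"
      using reachable_mk_symmetric_closed[where X = X] sep uv XY(3) unfolding M_def by blast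
    then show "U \<noteq> {} \<and> (\<exists>u\<in>U. \<exists>v\<in>U. \<not> u \<rightarrow>\<^sup>*\<^bsub>M\<^esub> v)"
      using uv XY(4) by blast
  next
    assume "U \<noteq> {} \<and> (\<exists>u\<in>U. \<exists>v\<in>U. \<not> u \<rightarrow>\<^sup>*\<^bsub>M\<^esub> v)"
    then obtain u v where uv: "u \<in> U" "v \<in> U" "\<not> u \<rightarrow>\<^sup>*\<^bsub>M\<^esub> v" by blast
    \<comment> \<open>The component of \<open>u\<close>: an edge from it to another vertex of
      \<open>U\<close> would make that vertex reachable too.\<close>
    define X where "X = {z \<in> U. u \<rightarrow>\<^sup>*\<^bsub>M\<^esub> z}"
    have "u \<in> X"
      using uv(1) by (auto simp: X_def M_def reachable_def)
    moreover have "v \<in> U - X"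
      using uv by (simp add: X_def)
    moreover have "\<not> adjacent G a b" if "a \<in> X" "b \<in> U - X" for a b
    proof
      assume "adjacent G a b"
      then have "(a, b) \<in> arcs_ends M"
        using that by (auto simp: M_def X_def parcs_mk_symmetric adjacent_def intro!: bexI[of _ "(a, b)"])
      moreover have "b \<in> verts M"
        using that by (simp add: M_def)
      ultimately have "u \<rightarrow>\<^sup>*\<^bsub>M\<^esub> b"
        using that rtrancl_on_into_rtrancl_on[of u a "verts M" "arcs_ends M" b]
        by (simp add: X_def reachable_def)
      then show False
        using that by (simp add: X_def)
    qed
    ultimately have "separation G S X (U - X)"
      by (auto simp: separation_def X_def U_def)
    then show ?P by blast
  qed
  then have "U \<noteq> {} \<and> \<not> Digraph_Component.connected (with_proj G \<restriction> U) \<longleftrightarrow> ?P"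
    unfolding conn by auto
  then show ?thesis
    unfolding disconnecting_set_def U_def by simp
qed

text \<open>The neighborhood of a vertex with a non-neighbor cuts that vertex off, and local
  finiteness makes it finite. Thus the \<open>LEAST\<close> in \<open>connectivity\<close> is
  attained.\<close>

lemma ex_finite_disconnecting_set:
  assumes "\<not> complete_graph G"
  shows "\<exists>S. finite S \<and> disconnecting_set G S"
proof -
  obtain x y where xy: "x \<in> pverts G" "y \<in> pverts G" "x \<noteq> y" "\<not> adjacent G x y"
    using assms by (auto simp: complete_graph_def)
  then have "separation G (neighbors G x) {x} (pverts G - neighbors G x - {x})"
    using adjacent_neq[of x x] by (auto simp: separation_def)
  moreover have "neighbors G x \<subseteq> pverts G"
    using adjacent_in_pverts by auto
  ultimately have "disconnecting_set G (neighbors G x)"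
    by (auto simp: disconnecting_set_iff)
  then show ?thesis using finite_neighbors by blast
qed

lemma connectivity_le: "finite S \<Longrightarrow> disconnecting_set G S \<Longrightarrow> connectivity G \<le> card S"
  unfolding connectivity_def by (intro Least_le) blast

lemma ex_minimum_disconnecting_set:
  assumes "\<not> complete_graph G"
  shows "\<exists>S. finite S \<and> card S = connectivity G \<and> disconnecting_set G S"
proof -
  have "\<exists>n S. finite S \<and> card S = n \<and> disconnecting_set G S"
    using ex_finite_disconnecting_set[OF assms] by blast
  then show ?thesis
    unfolding connectivity_def by (rule LeastI_ex)
qed

text \<open>Otherwise \<open>w\<close> could be moved to the side \<open>Y\<close>, and
  \<open>W - {w}\<close> would be a smaller cut.\<close>

lemma minimum_cut_neighbor:
  assumes "card W = connectivity G" "finite W" "W \<subseteq> pverts G" "w \<in> W"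
    and "separation G W X Y"
  shows "\<exists>x\<in>X. adjacent G x w"
proof (rule ccontr)
  assume no: "\<not> (\<exists>x\<in>X. adjacent G x w)"
  have "separation G (W - {w}) X (insert w Y)"
    using assms(3-5) no unfolding separation_def by auto
  then have "disconnecting_set G (W - {w})"
    using assms(3) by (auto simp: disconnecting_set_iff)
  then have "card W \<le> card (W - {w})"
    using connectivity_le assms(1,2) by simp
  moreover have "card (W - {w}) < card W"
    using assms(2,4) by (rule card_Diff1_less)
  ultimately show False by simp
qed

end

text \<open>If nothing is removed, no edge crosses between the two sides, so a function constant on
  each side is Lipschitz however large its jump.\<close>

lemma (in connected_locally_finite_graph) disconnecting_set_nonempty:
  assumes "disconnecting_set G W"
  shows "W \<noteq> {}"
proof
  assume "W = {}"
  then obtain X Y where XY: "separation G {} X Y"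
    using assms by (auto simp: disconnecting_set_iff)
  then obtain a b where ab: "a \<in> X" "b \<in> Y" "a \<notin> Y" "a \<in> pverts G" "b \<in> pverts G"
    by (auto simp: separation_def)
  \<comment> \<open>The jump exceeds the distance from \<open>a\<close> to \<open>b\<close> by 1,
    which contradicts the Lipschitz bound.\<close>
  define f where "f v = (if v \<in> Y then real (graph_dist G a b) + 1 else 0)" for v
  have "f v - f u \<le> 1" if "adjacent G u v" for u v
    using that XY adjacent_in_pverts[OF that] by (auto simp: f_def separation_def)
  then have "f b - f a \<le> real (graph_dist G a b)"
    using lipschitz_graph_dist ab by blast
  then show False
    using ab by (simp add: f_def)
qed

section \<open>Optimal transport between finitely supported measures\<close>

definition transport_costs :: "'a pair_pre_digraph \<Rightarrow> ('a \<Rightarrow> real) \<Rightarrow> ('a \<Rightarrow> real) \<Rightarrow> real set" where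
  "transport_costs G \<rho> \<sigma> = {c. \<exists>\<pi>. coupling (pverts G) \<rho> \<sigma> \<pi> \<and>
    ((\<lambda>(x, y). real (graph_dist G x y) * \<pi> x y) has_sum c) (pverts G \<times> pverts G)}"

lemma wasserstein_eq_Inf: "wasserstein G \<rho> \<sigma> = Inf (transport_costs G \<rho> \<sigma>)"
  by (simp add: wasserstein_def transport_costs_def)

text \<open>\<open>A\<close> only has to contain the support, so the closed ball around a vertex
  serves for every idleness, including 0 and 1.\<close>

definition finite_distribution :: "'a set \<Rightarrow> 'a set \<Rightarrow> ('a \<Rightarrow> real) \<Rightarrow> bool" where
  "finite_distribution V A \<rho> \<longleftrightarrow> finite A \<and> A \<subseteq> V \<and> (\<forall>x\<in>A. 0 \<le> \<rho> x) \<and> (\<forall>x\<in>V - A. \<rho> x = 0) \<and> sum \<rho> A = 1"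

lemma finite_distribution_nonneg: "finite_distribution V A \<rho> \<Longrightarrow> x \<in> V \<Longrightarrow> 0 \<le> \<rho> x"
  by (cases "x \<in> A") (auto simp: finite_distribution_def)

lemma finite_distribution_le_1: "finite_distribution V A \<rho> \<Longrightarrow> x \<in> V \<Longrightarrow> \<rho> x \<le> 1"
  by (cases "x \<in> A") (auto simp: finite_distribution_def dest: member_le_sum[of x A \<rho>])

lemma has_sum_finite_support:
  fixes f :: "'a \<Rightarrow> real"
  assumes "finite A" "A \<subseteq> V" "\<And>x. x \<in> V - A \<Longrightarrow> f x = 0"
  shows "(f has_sum c) V \<longleftrightarrow> c = sum f A"
proof -
  have "(f has_sum c) V \<longleftrightarrow> (f has_sum c) A"
    using assms by (intro has_sum_cong_neutral) auto
  then show ?thesis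
    using assms(1) by (simp add: has_sum_finite_iff)
qed

text \<open>A nonnegative entry is at most its row sum and its column sum, and one of these vanishes
  here.\<close>

lemma coupling_outside_support:
  assumes \<pi>: "coupling V \<rho> \<sigma> \<pi>"
    and "finite_distribution V A \<rho>" "finite_distribution V B \<sigma>"
    and "x \<in> V" "y \<in> V" "x \<notin> A \<or> y \<notin> B"
  shows "\<pi> x y = 0"
proof -
  have row: "(\<pi> x has_sum \<rho> x) V" and col: "((\<lambda>x. \<pi> x y) has_sum \<sigma> y) V"
    and nonneg: "\<And>x y. x \<in> V \<Longrightarrow> y \<in> V \<Longrightarrow> 0 \<le> \<pi> x y"
    using \<pi> assms(4,5) by (auto simp: coupling_def)
  have "\<pi> x y \<le> \<rho> x"
    using finite_sum_le_has_sum[OF row, of "{y}"] nonneg assms(4,5) by simp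
  moreover have "\<pi> x y \<le> \<sigma> y"
    using finite_sum_le_has_sum[OF col, of "{x}"] nonneg assms(4,5) by simp
  moreover have "\<rho> x = 0 \<or> \<sigma> y = 0"
    using assms by (auto simp: finite_distribution_def)
  ultimately show ?thesis
    using nonneg[OF assms(4,5)] by linarith
qed

lemma coupling_marginals:
  assumes \<pi>: "coupling V \<rho> \<sigma> \<pi>"
    and A: "finite_distribution V A \<rho>" and B: "finite_distribution V B \<sigma>"
  shows "x \<in> A \<Longrightarrow> (\<Sum>y\<in>B. \<pi> x y) = \<rho> x"
    and "y \<in> B \<Longrightarrow> (\<Sum>x\<in>A. \<pi> x y) = \<sigma> y"
proof -
  have AV: "finite A" "A \<subseteq> V" and BV: "finite B" "B \<subseteq> V"
    using A B by (auto simp: finite_distribution_def)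
  show "(\<Sum>y\<in>B. \<pi> x y) = \<rho> x" if "x \<in> A"
  proof -
    have "(\<pi> x has_sum \<rho> x) V"
      using \<pi> that AV by (auto simp: coupling_def)
    then show ?thesis
      using has_sum_finite_support[OF BV, of "\<pi> x"] coupling_outside_support[OF assms, of x] that AV
      by auto
  qed
  show "(\<Sum>x\<in>A. \<pi> x y) = \<sigma> y" if "y \<in> B"
  proof -
    have "((\<lambda>x. \<pi> x y) has_sum \<sigma> y) V"
      using \<pi> that BV by (auto simp: coupling_def)
    then show ?thesis
      using has_sum_finite_support[OF AV, of "\<lambda>x. \<pi> x y"] coupling_outside_support[OF assms, of _ y] that BV
      by auto
  qed
qed

text \<open>Couplings vanish off \<open>A \<times> B\<close>, so every coupling has finite cost and
  the infinite sum becomes a finite one.\<close>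

lemma transport_costs_iff:
  assumes A: "finite_distribution (pverts G) A \<rho>" and B: "finite_distribution (pverts G) B \<sigma>"
  shows "c \<in> transport_costs G \<rho> \<sigma> \<longleftrightarrow>
    (\<exists>\<pi>. coupling (pverts G) \<rho> \<sigma> \<pi> \<and> c = (\<Sum>x\<in>A. \<Sum>y\<in>B. real (graph_dist G x y) * \<pi> x y))"
proof -
  have "((\<lambda>(x, y). real (graph_dist G x y) * \<pi> x y) has_sum c) (pverts G \<times> pverts G) \<longleftrightarrow>
      c = (\<Sum>x\<in>A. \<Sum>y\<in>B. real (graph_dist G x y) * \<pi> x y)"
    if "coupling (pverts G) \<rho> \<sigma> \<pi>" for \<pi>
  proof (subst has_sum_finite_support[of "A \<times> B"])
    show "(case z of (x, y) \<Rightarrow> real (graph_dist G x y) * \<pi> x y) = 0"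
      if "z \<in> pverts G \<times> pverts G - A \<times> B" for z
    proof -
      have "\<pi> (fst z) (snd z) = 0"
        by (rule coupling_outside_support[OF \<open>coupling _ _ _ _\<close> A B]) (use that in auto)
      then show ?thesis by (simp add: case_prod_unfold)
    qed
  qed (use A B in \<open>auto simp: finite_distribution_def sum.cartesian_product\<close>)
  then show ?thesis
    unfolding transport_costs_def by auto
qed

text \<open>Serves twice: it makes the set of costs nonempty, so that its infimum is meaningful, and
  its cost bounds the curvature from below.\<close>

lemma product_coupling:
  assumes A: "finite_distribution V A \<rho>" and B: "finite_distribution V B \<sigma>"
  shows "coupling V \<rho> \<sigma> (\<lambda>x y. \<rho> x * \<sigma> y)"
  unfolding coupling_def
proof (intro conjI ballI)
  fix x y assume xy: "x \<in> V" "y \<in> V"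
  show "0 \<le> \<rho> x * \<sigma> y" "\<rho> x * \<sigma> y \<le> 1"
    using xy finite_distribution_nonneg[OF A] finite_distribution_le_1[OF A]
      finite_distribution_nonneg[OF B] finite_distribution_le_1[OF B]
    by (auto intro: mult_le_one)
next
  fix x assume "x \<in> V"
  show "((\<lambda>y. \<rho> x * \<sigma> y) has_sum \<rho> x) V"
    using B by (subst has_sum_finite_support[of B])
      (auto simp: finite_distribution_def simp flip: sum_distrib_left)
next
  fix y assume "y \<in> V"
  show "((\<lambda>x. \<rho> x * \<sigma> y) has_sum \<sigma> y) V"
    using A by (subst has_sum_finite_support[of A])
      (auto simp: finite_distribution_def simp flip: sum_distrib_right)
qed

text \<open>A mixture of couplings couples the mixed marginals, and cost is linear in the coupling.
  Speaking of costs rather than of \<open>wasserstein\<close> avoids asking for an optimal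
  coupling.\<close>

lemma transport_costs_convex:
  assumes "c \<in> transport_costs G \<rho> \<sigma>" "c' \<in> transport_costs G \<rho>' \<sigma>'" "0 \<le> s" "s \<le> 1"
  shows "s * c + (1 - s) * c' \<in>
    transport_costs G (\<lambda>x. s * \<rho> x + (1 - s) * \<rho>' x) (\<lambda>x. s * \<sigma> x + (1 - s) * \<sigma>' x)"
proof -
  obtain \<pi> \<pi>' where \<pi>: "coupling (pverts G) \<rho> \<sigma> \<pi>" "coupling (pverts G) \<rho>' \<sigma>' \<pi>'"
    and c: "((\<lambda>(x, y). real (graph_dist G x y) * \<pi> x y) has_sum c) (pverts G \<times> pverts G)"
      "((\<lambda>(x, y). real (graph_dist G x y) * \<pi>' x y) has_sum c') (pverts G \<times> pverts G)"
    using assms(1,2) by (auto simp: transport_costs_def)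
  let ?\<pi> = "\<lambda>x y. s * \<pi> x y + (1 - s) * \<pi>' x y"
  have "coupling (pverts G) (\<lambda>x. s * \<rho> x + (1 - s) * \<rho>' x) (\<lambda>x. s * \<sigma> x + (1 - s) * \<sigma>' x) ?\<pi>"
    using \<pi> assms(3,4) unfolding coupling_def
    by (auto intro!: has_sum_add has_sum_cmult_right convex_bound_le)
  moreover have "((\<lambda>(x, y). real (graph_dist G x y) * ?\<pi> x y) has_sum s * c + (1 - s) * c')
      (pverts G \<times> pverts G)"
    using has_sum_add[OF has_sum_cmult_right[OF c(1), of s] has_sum_cmult_right[OF c(2), of "1 - s"]]
    by (simp add: case_prod_unfold algebra_simps)
  ultimately show ?thesis
    unfolding transport_costs_def by blast
qed

section \<open>Wasserstein bounds from test functions and from the product coupling\<close>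

context connected_locally_finite_graph
begin

text \<open>The easy half of Kantorovich duality: by the marginal conditions the left side is the
  sum of \<open>(f y - f x) * \<pi> x y\<close>, and the Lipschitz condition compares it with the
  cost.\<close>

lemma transport_cost_ge:
  assumes A: "finite_distribution (pverts G) A \<rho>" and B: "finite_distribution (pverts G) B \<sigma>"
    and c: "c \<in> transport_costs G \<rho> \<sigma>"
    and lip: "\<And>u v. adjacent G u v \<Longrightarrow> f v - f u \<le> 1"
  shows "(\<Sum>y\<in>B. f y * \<sigma> y) - (\<Sum>x\<in>A. f x * \<rho> x) \<le> c"
proof -
  obtain \<pi> where \<pi>: "coupling (pverts G) \<rho> \<sigma> \<pi>"
    and c: "c = (\<Sum>x\<in>A. \<Sum>y\<in>B. real (graph_dist G x y) * \<pi> x y)"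
    using c transport_costs_iff[OF A B] by auto
  have "(\<Sum>y\<in>B. f y * \<sigma> y) = (\<Sum>y\<in>B. \<Sum>x\<in>A. f y * \<pi> x y)"
    by (intro sum.cong refl) (simp add: coupling_marginals(2)[OF \<pi> A B] flip: sum_distrib_left)
  also have "\<dots> = (\<Sum>x\<in>A. \<Sum>y\<in>B. f y * \<pi> x y)"
    by (rule sum.swap)
  finally have \<sigma>: "(\<Sum>y\<in>B. f y * \<sigma> y) = (\<Sum>x\<in>A. \<Sum>y\<in>B. f y * \<pi> x y)" .
  have \<rho>: "(\<Sum>x\<in>A. f x * \<rho> x) = (\<Sum>x\<in>A. \<Sum>y\<in>B. f x * \<pi> x y)"
    by (intro sum.cong refl) (simp add: coupling_marginals(1)[OF \<pi> A B] flip: sum_distrib_left)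
  have "(\<Sum>y\<in>B. f y * \<sigma> y) - (\<Sum>x\<in>A. f x * \<rho> x) = (\<Sum>x\<in>A. \<Sum>y\<in>B. (f y - f x) * \<pi> x y)"
    unfolding \<rho> \<sigma> by (simp add: sum_subtractf left_diff_distrib)
  also have "\<dots> \<le> c"
    unfolding c
  proof (intro sum_mono mult_right_mono)
    fix x y assume "x \<in> A" "y \<in> B"
    then have xy: "x \<in> pverts G" "y \<in> pverts G"
      using A B by (auto simp: finite_distribution_def)
    then show "0 \<le> \<pi> x y"
      using \<pi> by (simp add: coupling_def)
    show "f y - f x \<le> real (graph_dist G x y)"
      using lipschitz_graph_dist[of f x y] lip xy by blast
  qed
  finally show ?thesis .
qed

lemma transport_cost_nonneg:
  assumes "finite_distribution (pverts G) A \<rho>" "finite_distribution (pverts G) B \<sigma>"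
    and "c \<in> transport_costs G \<rho> \<sigma>"
  shows "0 \<le> c"
  using transport_cost_ge[OF assms, of "\<lambda>_. 0"] by simp

lemma wasserstein_le:
  assumes "finite_distribution (pverts G) A \<rho>" "finite_distribution (pverts G) B \<sigma>"
    and "c \<in> transport_costs G \<rho> \<sigma>"
  shows "wasserstein G \<rho> \<sigma> \<le> c"
  unfolding wasserstein_eq_Inf
  using assms(3) transport_cost_nonneg[OF assms(1,2)] by (intro cInf_lower bdd_belowI)

lemma transport_costs_nonempty:
  assumes "finite_distribution (pverts G) A \<rho>" "finite_distribution (pverts G) B \<sigma>"
  shows "transport_costs G \<rho> \<sigma> \<noteq> {}"
  using product_coupling[OF assms] transport_costs_iff[OF assms] by blast

lemma wasserstein_ge:
  assumes "finite_distribution (pverts G) A \<rho>" "finite_distribution (pverts G) B \<sigma>"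
    and "\<And>u v. adjacent G u v \<Longrightarrow> f v - f u \<le> 1"
  shows "(\<Sum>y\<in>B. f y * \<sigma> y) - (\<Sum>x\<in>A. f x * \<rho> x) \<le> wasserstein G \<rho> \<sigma>"
  unfolding wasserstein_eq_Inf
  using transport_costs_nonempty[OF assms(1,2)] transport_cost_ge[OF assms(1,2) _ assms(3)]
  by (rule cInf_greatest)

text \<open>Under the product coupling, mass going from \<open>a\<close> to \<open>b\<close> is
  routed through \<open>x\<close> and then \<open>y\<close>. As both measures have total mass 1, the
  three legs separate.\<close>

lemma wasserstein_le_star:
  assumes A: "finite_distribution (pverts G) A \<rho>" and B: "finite_distribution (pverts G) B \<sigma>"
    and xy: "x \<in> pverts G" "y \<in> pverts G"
  shows "wasserstein G \<rho> \<sigma> \<le> (\<Sum>a\<in>A. real (graph_dist G a x) * \<rho> a) + real (graph_dist G x y) +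
    (\<Sum>b\<in>B. real (graph_dist G y b) * \<sigma> b)"
proof -
  let ?d = "\<lambda>a b. real (graph_dist G a b)"
  have sums: "sum \<rho> A = 1" "sum \<sigma> B = 1"
    using A B by (auto simp: finite_distribution_def)
  have "wasserstein G \<rho> \<sigma> \<le> (\<Sum>a\<in>A. \<Sum>b\<in>B. ?d a b * (\<rho> a * \<sigma> b))"
    using product_coupling[OF A B] transport_costs_iff[OF A B]
    by (intro wasserstein_le[OF A B]) blast
  also have "\<dots> \<le> (\<Sum>a\<in>A. \<Sum>b\<in>B. (?d a x + ?d x y + ?d y b) * (\<rho> a * \<sigma> b))"
  proof (intro sum_mono mult_right_mono)
    fix a b assume "a \<in> A" "b \<in> B"
    then have ab: "a \<in> pverts G" "b \<in> pverts G"
      using A B by (auto simp: finite_distribution_def)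
    show "0 \<le> \<rho> a * \<sigma> b"
      using ab finite_distribution_nonneg[OF A] finite_distribution_nonneg[OF B] by simp
    show "?d a b \<le> ?d a x + ?d x y + ?d y b"
      using graph_dist_triangle[of a x b] graph_dist_triangle[of x y b] ab xy by linarith
  qed
  also have "\<dots> = (\<Sum>a\<in>A. ?d a x * \<rho> a) * sum \<sigma> B + ?d x y * (sum \<rho> A * sum \<sigma> B) +
      sum \<rho> A * (\<Sum>b\<in>B. ?d y b * \<sigma> b)"
    unfolding sum_product unfolding sum_distrib_left sum.distrib[symmetric]
    by (intro sum.cong refl) (simp add: algebra_simps)
  finally show ?thesis
    by (simp add: sums)
qed

end

section \<open>Curvature and the graph Laplacian\<close>

definition laplacian :: "'a pair_pre_digraph \<Rightarrow> ('a \<Rightarrow> real) \<Rightarrow> 'a \<Rightarrow> real" where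
  "laplacian G f x = (\<Sum>z\<in>neighbors G x. f z - f x) / real (degree G x)"

context locally_finite_graph
begin

text \<open>The mean of \<open>f\<close> after one lazy step differs from \<open>f x\<close> by a
  multiple of \<open>1 - p\<close>, so dividing by \<open>1 - p\<close> later removes
  \<open>p\<close> from the test-function bound.\<close>

lemma sum_lazy_walk:
  assumes "degree G x > 0"
  shows "(\<Sum>z\<in>insert x (neighbors G x). f z * lazy_walk G p x z) = f x + (1 - p) * laplacian G f x"
proof -
  have "x \<notin> neighbors G x"
    using adjacent_neq[of x x] by auto
  then have "(\<Sum>z\<in>insert x (neighbors G x). f z * lazy_walk G p x z) =
      f x * p + (\<Sum>z\<in>neighbors G x. f z * lazy_walk G p x z)"
    by (simp add: finite_neighbors lazy_walk_def)
  also have "(\<Sum>z\<in>neighbors G x. f z * lazy_walk G p x z) =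
      (\<Sum>z\<in>neighbors G x. f z * ((1 - p) / real (degree G x)))"
    using \<open>x \<notin> neighbors G x\<close> by (intro sum.cong) (auto simp: lazy_walk_def)
  also have "\<dots> = (1 - p) / real (degree G x) * (\<Sum>z\<in>neighbors G x. f z)"
    unfolding sum_distrib_left by (intro sum.cong refl mult.commute)
  also have "(\<Sum>z\<in>neighbors G x. f z) = real (degree G x) * (laplacian G f x + f x)"
    using assms by (simp add: laplacian_def sum_subtractf distrib_left flip: degree_eq)
  also have "f x * p + (1 - p) / real (degree G x) * (real (degree G x) * (laplacian G f x + f x)) =
      f x * p + (1 - p) * (laplacian G f x + f x)"
    using assms by simp
  finally show ?thesis
    by (simp add: algebra_simps)
qed

lemma finite_distribution_lazy_walk:
  assumes "adjacent G x y" "0 \<le> p" "p \<le> 1"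
  shows "finite_distribution (pverts G) (insert x (neighbors G x)) (lazy_walk G p x)"
proof -
  have "(\<Sum>z\<in>insert x (neighbors G x). lazy_walk G p x z) = 1"
    using sum_lazy_walk[of x "\<lambda>_. 1" p] degree_pos[OF assms(1)] by (simp add: laplacian_def)
  then show ?thesis
    using adjacent_in_pverts finite_neighbors assms
    by (auto simp: finite_distribution_def lazy_walk_def)
qed

text \<open>The lazy walk is affine in its idleness and becomes a point mass at idleness 1.\<close>

lemma lazy_walk_convex:
  assumes "1 - q = s * (1 - p)"
  shows "lazy_walk G q x = (\<lambda>z. s * lazy_walk G p x z + (1 - s) * lazy_walk G 1 x z)"
proof
  fix z
  have "q = s * p + (1 - s)"
    using assms by (simp add: algebra_simps)
  then show "lazy_walk G q x z = s * lazy_walk G p x z + (1 - s) * lazy_walk G 1 x z"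
    using assms by (simp add: lazy_walk_def)
qed

end

section \<open>Curvature bounds and existence of the limit\<close>

context connected_locally_finite_graph
begin

lemma laplacian_graph_dist:
  assumes "degree G x > 0" "x \<in> pverts G"
  shows "laplacian G (\<lambda>z. real (graph_dist G x z)) x = 1"
    and "laplacian G (\<lambda>z. real (graph_dist G z x)) x = 1"
  using assms adjacent_sym
  by (simp_all add: laplacian_def graph_dist_refl graph_dist_adjacent degree_eq)

text \<open>Both lazy walks have mean distance \<open>1 - p\<close> from their centers, so routing
  all mass along the edge costs at most \<open>1 + 2 * (1 - p)\<close>.\<close>

lemma kappa_ge:
  assumes "adjacent G x y" "0 \<le> p" "p < 1"
  shows "- 2 * (1 - p) \<le> kappa G p x y"
proof -
  note yx = adjacent_sym[OF assms(1)]
  have "wasserstein G (lazy_walk G p x) (lazy_walk G p y) \<le> (1 - p) + 1 + (1 - p)"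
    using wasserstein_le_star[OF finite_distribution_lazy_walk[OF assms(1), of p]
        finite_distribution_lazy_walk[OF yx, of p] adjacent_in_pverts[OF assms(1)]]
      sum_lazy_walk[of x "\<lambda>z. real (graph_dist G z x)" p]
      sum_lazy_walk[of y "\<lambda>z. real (graph_dist G y z)" p]
      laplacian_graph_dist(2)[of x] laplacian_graph_dist(1)[of y]
      degree_pos[OF assms(1)] degree_pos[OF yx] adjacent_in_pverts[OF assms(1)]
      graph_dist_refl graph_dist_adjacent[OF assms(1)] assms(2,3)
    by simp
  then show ?thesis
    by (simp add: kappa_def graph_dist_adjacent[OF assms(1)])
qed

text \<open>Since \<open>f\<close> rises by exactly the distance 1 along the edge, the constant
  terms cancel and only multiples of \<open>1 - p\<close> remain.\<close>

lemma kappa_le_laplacian: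
  assumes "adjacent G x y" "0 \<le> p" "p < 1"
    and "\<And>u v. adjacent G u v \<Longrightarrow> f v - f u \<le> 1" and "f y - f x = 1"
  shows "kappa G p x y \<le> (1 - p) * (laplacian G f x - laplacian G f y)"
proof -
  note yx = adjacent_sym[OF assms(1)]
  have "f y + (1 - p) * laplacian G f y - (f x + (1 - p) * laplacian G f x) \<le>
      wasserstein G (lazy_walk G p x) (lazy_walk G p y)"
    using wasserstein_ge[OF finite_distribution_lazy_walk[OF assms(1), of p]
        finite_distribution_lazy_walk[OF yx, of p], of f] assms(2-4)
      sum_lazy_walk[OF degree_pos[OF assms(1)]] sum_lazy_walk[OF degree_pos[OF yx]]
    by simp
  then show ?thesis
    using assms(5) by (simp add: kappa_def graph_dist_adjacent[OF assms(1)] algebra_simps)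
qed

text \<open>The walk with idleness \<open>q\<close> mixes the walk with idleness \<open>p\<close>,
  of weight \<open>s\<close>, and a point mass. Mixing couplings accordingly gives
  \<open>1 - W(q) \<ge> s * (1 - W(p))\<close>.\<close>

lemma kappa_ratio_mono:
  assumes xy: "adjacent G x y" and pq: "0 \<le> p" "p \<le> q" "q < 1"
  shows "kappa G p x y / (1 - p) \<le> kappa G q x y / (1 - q)"
proof -
  note yx = adjacent_sym[OF xy]
  let ?W = "\<lambda>p. wasserstein G (lazy_walk G p x) (lazy_walk G p y)"
  have fd: "finite_distribution (pverts G) (insert x (neighbors G x)) (lazy_walk G p x)"
    "finite_distribution (pverts G) (insert y (neighbors G y)) (lazy_walk G p y)"
    if "0 \<le> p" "p \<le> 1" for p
    using finite_distribution_lazy_walk xy yx that by blast+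
  define s where "s = (1 - q) / (1 - p)"
  have s: "1 - q = s * (1 - p)" "0 < s" "s \<le> 1"
    using pq by (auto simp: s_def divide_simps)
  have point: "finite_distribution (pverts G) {z} (lazy_walk G 1 z)" if "z \<in> pverts G" for z
    using that by (auto simp: finite_distribution_def lazy_walk_def)
  \<comment> \<open>The point masses at the ends of the edge are coupled by moving unit mass over
    distance 1.\<close>
  have "1 \<in> transport_costs G (lazy_walk G 1 x) (lazy_walk G 1 y)"
    using transport_costs_iff[OF point point] product_coupling[OF point point]
      adjacent_in_pverts[OF xy] graph_dist_adjacent[OF xy]
    by (force simp: lazy_walk_def)
  then have "?W q \<le> s * c + (1 - s)"
    if "c \<in> transport_costs G (lazy_walk G p x) (lazy_walk G p y)" for c
    using wasserstein_le[OF fd[of q], of "s * c + (1 - s)"]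
      transport_costs_convex[OF that, of 1 "lazy_walk G 1 x" "lazy_walk G 1 y" s] s pq
    by (simp flip: lazy_walk_convex[OF s(1)])
  \<comment> \<open>Solving the previous bound for \<open>c\<close> gives a lower bound on all costs
    at idleness \<open>p\<close>, hence on their infimum.\<close>
  then have "(?W q - (1 - s)) / s \<le> ?W p"
    unfolding wasserstein_eq_Inf[of G "lazy_walk G p x"] using pq s(2)
    by (intro cInf_greatest transport_costs_nonempty[OF fd]) (auto simp: field_simps)
  then have "s * (1 - ?W p) \<le> 1 - ?W q"
    using s(2) by (simp add: field_simps)
  then have "s * kappa G p x y \<le> kappa G q x y"
    by (simp add: kappa_def graph_dist_adjacent[OF xy])
  then show ?thesis
    using pq by (simp add: s_def field_simps)
qed

text \<open>The ratio increases with \<open>p\<close> and is at most \<open>b\<close>, so it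
  converges and \<open>Lim\<close> denotes a genuine limit, which inherits both bounds.\<close>

lemma kappa_LLY_bounds:
  assumes xy: "adjacent G x y"
    and bound: "\<And>p. 0 < p \<Longrightarrow> p < 1 \<Longrightarrow> a \<le> kappa G p x y / (1 - p) \<and> kappa G p x y / (1 - p) \<le> b"
  shows "a \<le> kappa_LLY G x y \<and> kappa_LLY G x y \<le> b"
proof -
  let ?g = "\<lambda>p. kappa G p x y / (1 - p)"
  \<comment> \<open>Monotonicity is available for nonnegative idleness, so the limit is taken within
    (0,1); near 1 this is the same as approaching from the left.\<close>
  have "(?g \<longlongrightarrow> Sup (?g ` ({..<1} \<inter> {0<..}))) (at 1 within ({..<1} \<inter> {0<..}))"
    by (rule Lim_left_bound[where K = b]) (use kappa_ratio_mono[OF xy] bound in auto)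
  moreover have "at (1::real) within ({..<1} \<inter> {0<..}) = at_left 1"
    by (rule at_within_nhd[where S = "{0<..}"]) auto
  ultimately obtain L where L: "(?g \<longlongrightarrow> L) (at_left 1)" by auto
  have "eventually (\<lambda>p. 0 < p \<and> p < 1) (at_left (1::real))"
    using eventually_at_left_real[of 0 1] by (auto elim: eventually_mono)
  then have "eventually (\<lambda>p. a \<le> ?g p) (at_left 1)" "eventually (\<lambda>p. ?g p \<le> b) (at_left 1)"
    using bound by (auto elim: eventually_mono)
  then have "a \<le> L" "L \<le> b"
    using L by (auto intro: tendsto_lowerbound tendsto_upperbound)
  moreover have "kappa_LLY G x y = L"
    unfolding kappa_LLY_def using L by (intro tendsto_Lim) auto
  ultimately show ?thesis by simp
qed

lemma kappa_LLY_laplacian_bounds: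
  assumes "adjacent G x y"
    and "\<And>u v. adjacent G u v \<Longrightarrow> f v - f u \<le> 1" and "f y - f x = 1"
  shows "- 2 \<le> kappa_LLY G x y \<and> kappa_LLY G x y \<le> laplacian G f x - laplacian G f y"
proof (rule kappa_LLY_bounds[OF assms(1)])
  fix p :: real assume p: "0 < p" "p < 1"
  then show "- 2 \<le> kappa G p x y / (1 - p) \<and>
      kappa G p x y / (1 - p) \<le> laplacian G f x - laplacian G f y"
    using kappa_ge[OF assms(1), of p] kappa_le_laplacian[OF assms(1), of p f] assms(2,3)
    by (simp add: pos_le_divide_eq pos_divide_le_eq mult.commute)
qed

lemma kappa_LLY_graph_le:
  assumes "adjacent G x y"
  shows "kappa_LLY_graph G \<le> kappa_LLY G x y"
proof -
  have "- 2 \<le> kappa_LLY G u v" if "adjacent G u v" for u v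
  proof -
    \<comment> \<open>The distance from \<open>u\<close> is an admissible test function for any edge
      at \<open>u\<close>. It supplies the upper bound that makes the limit exist.\<close>
    have "real (graph_dist G u b) - real (graph_dist G u a) \<le> 1" if "adjacent G a b" for a b
      using graph_dist_triangle[of u a b] graph_dist_adjacent[OF that] adjacent_in_pverts[OF that]
        adjacent_in_pverts[OF \<open>adjacent G u v\<close>] by simp
    then show ?thesis
      using kappa_LLY_laplacian_bounds[OF that, of "\<lambda>z. real (graph_dist G u z)"]
        graph_dist_refl graph_dist_adjacent[OF that] adjacent_in_pverts[OF that] by simp
  qed
  then show ?thesis
    unfolding kappa_LLY_graph_def using assms
    by (intro cInf_lower) (auto simp: bdd_below_def)
qed

end

section \<open>Curvature across a vertex cut\<close>

lemma sum_indicator_card: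
  "finite A \<Longrightarrow> (\<Sum>z\<in>A. if P z then 1 else 0 :: real) = real (card {z \<in> A. P z})"
  by (simp add: sum.If_cases Int_def)

context connected_locally_finite_graph
begin

lemma card_common_neighbors_ge:
  assumes "X \<inter> W = {}"
  shows "card (neighbors G x \<inter> neighbors G y \<inter> X) + card (neighbors G x \<inter> neighbors G y \<inter> W) \<le>
    card (common_neighbors G x y)"
proof -
  let ?A = "neighbors G x \<inter> neighbors G y"
  have "card (?A \<inter> X) + card (?A \<inter> W) = card (?A \<inter> X \<union> ?A \<inter> W)"
    using assms finite_neighbors by (intro card_Un_disjoint[symmetric]) auto
  also have "\<dots> \<le> card ?A"
    using finite_neighbors by (intro card_mono) auto
  finally show ?thesis
    by (simp add: common_neighbors_eq)
qed

text \<open>The quotient over \<open>degree G x\<close>, minus 1, is the Laplacian of the test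
  function at \<open>x\<close>; the remaining quotient is minus its Laplacian at
  \<open>w\<close>.\<close>

lemma kappa_LLY_cut_le:
  assumes sep: "separation G W X Y" and "W \<subseteq> pverts G"
    and w: "w \<in> W" and x: "x \<in> X" "adjacent G x w"
  shows "kappa_LLY G x w \<le>
    (real (card (neighbors G x \<inter> W - {w})) + real (card (neighbors G x \<inter> neighbors G w \<inter> X)) + 2)
      / real (degree G x) - 1
    + (real (card (neighbors G w \<inter> X)) + real (card (neighbors G w \<inter> W))) / real (degree G w)"
    (is "_ \<le> (?a + ?b + 2) / _ - 1 + (?c + ?m) / _")
proof -
  define f :: "'a \<Rightarrow> real" where
    "f z = (if z \<in> Y \<or> z = w then 0 else if z \<in> X \<and> \<not> adjacent G z w then - 2 else - 1)" for z
  have XY: "X \<inter> Y = {}" "X \<union> Y = pverts G - W" "\<And>a b. a \<in> X \<Longrightarrow> b \<in> Y \<Longrightarrow> \<not> adjacent G a b"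
    using sep by (auto simp: separation_def)
  have [simp]: "w \<notin> X" "w \<notin> Y" "x \<noteq> w" "x \<notin> Y"
    using XY w x by auto
  \<comment> \<open>A jump of 2 would need an edge from a vertex of value -2 to \<open>Y\<close> or
    to \<open>w\<close>. The separation excludes the first, and raising the neighbors of
    \<open>w\<close> to -1 excludes the second.\<close>
  have lip: "f v - f u \<le> 1" if "adjacent G u v" for u v
    using XY(3)[of u v] adjacent_sym[OF that] that XY adjacent_in_pverts[OF that]
    by (auto simp: f_def)
  have f_xw: "f x = - 1" "f w = 0"
    using x by (auto simp: f_def)
  \<comment> \<open>No neighbor of \<open>x\<close> lies in \<open>Y\<close>. Relative to -1, the
    vertex \<open>w\<close> contributes 1, the rest of \<open>W\<close> and the neighbors of
    \<open>w\<close> in \<open>X\<close> contribute 0, all others -1. Writing each value as a count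
    minus 1 gives \<open>w\<close> the weight 2.\<close>
  have "(\<Sum>z\<in>neighbors G x. f z - f x) =
    (\<Sum>z\<in>neighbors G x. (if z \<in> W \<and> z \<noteq> w then 1 else 0) + (if adjacent G w z \<and> z \<in> X then 1 else 0)
      + (if z = w then 2 else 0) - 1)"
  proof (intro sum.cong refl)
    fix z assume "z \<in> neighbors G x"
    then have "z \<in> pverts G" "z \<notin> Y"
      using adjacent_in_pverts(2)[of x z] XY(3)[of x z] x(1) by auto
    moreover have "adjacent G z w \<longleftrightarrow> adjacent G w z"
      using adjacent_sym by blast
    ultimately show "f z - f x = (if z \<in> W \<and> z \<noteq> w then 1 else 0) +
        (if adjacent G w z \<and> z \<in> X then 1 else 0) + (if z = w then 2 else 0) - 1"
      using XY(1,2) w unfolding f_xw(1) f_def[of z] by auto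
  qed
  also have "\<dots> = ?a + ?b + 2 - real (degree G x)"
    using x(2) finite_neighbors[of x]
    by (simp add: sum_subtractf sum.distrib sum_indicator_card degree_eq)
      (auto intro!: arg_cong2[where f = "(+)"] arg_cong[where f = card])
  finally have lap_x: "laplacian G f x = (?a + ?b + 2) / real (degree G x) - 1"
    using degree_pos[OF x(2)] by (simp add: laplacian_def diff_divide_distrib)
  \<comment> \<open>Neighbors of \<open>w\<close> in \<open>X\<close> have been raised to -1, so
    they weigh the same as those in \<open>W\<close>; those in \<open>Y\<close> contribute
    0.\<close>
  have "(\<Sum>z\<in>neighbors G w. f z - f w) =
    (\<Sum>z\<in>neighbors G w. - ((if z \<in> X then 1 else 0) + (if z \<in> W then 1 else 0)))"
  proof (intro sum.cong refl)
    fix z assume "z \<in> neighbors G w"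
    then have "z \<in> pverts G" "adjacent G z w" "z \<noteq> w"
      using adjacent_in_pverts(2)[of w z] adjacent_sym[of w z] adjacent_neq[of w z] by auto
    then show "f z - f w = - ((if z \<in> X then 1 else 0) + (if z \<in> W then 1 else 0))"
      using XY(1,2) by (auto simp: f_def)
  qed
  also have "\<dots> = - (?c + ?m)"
    using finite_neighbors[of w] unfolding sum_negf sum.distrib
    by (simp add: sum_indicator_card Int_def)
  finally have lap_w: "laplacian G f w = - ((?c + ?m) / real (degree G w))"
    unfolding laplacian_def by (simp only: minus_divide_left)
  have "kappa_LLY G x w \<le> laplacian G f x - laplacian G f w"
    using kappa_LLY_laplacian_bounds[OF x(2) lip] f_xw by simp
  then show ?thesis
    by (simp add: lap_x lap_w)
qed

end

text \<open>The inequality for truth values is summed over \<open>W - {w}\<close>. Restoring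
  \<open>w\<close> adds 1 to \<open>card W\<close> and 1 to
  \<open>card (A \<inter> B \<inter> W)\<close>, which pays for the 2 on the left. The sets
  \<open>A\<close>, \<open>B\<close>, \<open>C\<close> will be the neighborhoods of
  \<open>x\<close>, \<open>y\<close>, \<open>w\<close>.\<close>

lemma card_cut_inequality:
  assumes "finite W" "w \<in> W" "w \<notin> C" "w \<in> A \<inter> B"
  shows "card (A \<inter> W - {w}) + card (B \<inter> W - {w}) + card (C \<inter> W) + 2 \<le>
    card W + card (A \<inter> B \<inter> W) + card (A \<inter> C \<inter> W) + card (B \<inter> C \<inter> W)"
proof -
  define U where "U = W - {w}"
  have U: "finite U" using assms(1) by (simp add: U_def)
  have card: "card (S \<inter> U) = (\<Sum>z\<in>U. of_bool (z \<in> S))" for S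
    using U by (simp add: of_bool_def sum.If_cases Int_commute)
  have "(\<Sum>z\<in>U. of_bool (z \<in> A) + of_bool (z \<in> B) + of_bool (z \<in> C)) \<le>
      (\<Sum>z\<in>U. 1 + of_bool (z \<in> A \<inter> B) + of_bool (z \<in> A \<inter> C) + of_bool (z \<in> B \<inter> C) :: nat)"
    by (intro sum_mono) auto
  then have le: "card (A \<inter> U) + card (B \<inter> U) + card (C \<inter> U) \<le>
      card U + card (A \<inter> B \<inter> U) + card (A \<inter> C \<inter> U) + card (B \<inter> C \<inter> U)"
    unfolding card by (simp only: sum.distrib sum_constant) simp
  have eqs: "A \<inter> U = A \<inter> W - {w}" "B \<inter> U = B \<inter> W - {w}" "C \<inter> U = C \<inter> W"
    "A \<inter> C \<inter> U = A \<inter> C \<inter> W" "B \<inter> C \<inter> U = B \<inter> C \<inter> W"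
    using assms by (auto simp: U_def)
  have "card W = card U + 1"
    using card.remove[OF assms(1,2)] by (simp add: U_def)
  moreover have "A \<inter> B \<inter> W = insert w (A \<inter> B \<inter> U)"
    using assms by (auto simp: U_def)
  then have "card (A \<inter> B \<inter> W) = card (A \<inter> B \<inter> U) + 1"
    using U by (simp add: U_def)
  ultimately show ?thesis
    using le[unfolded eqs] by linarith
qed

theorem theorem1p3:
  fixes G :: "'a pair_pre_digraph" and \<alpha> \<beta> :: nat
  assumes "locally_finite_graph G"
    and "Digraph_Component.connected (with_proj G)"
    and "\<not> complete_graph G"
    and "\<And>x y. adjacent G x y \<Longrightarrow> card (common_neighbors G x y) \<le> \<alpha>"
    and "\<And>x y. x \<in> pverts G \<Longrightarrow> y \<in> pverts G \<Longrightarrow> graph_dist G x y = 2 \<Longrightarrow>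
           card (common_neighbors G x y) \<le> \<beta>"
  shows "real (connectivity G) \<ge>
    (2 * kappa_LLY_graph G + 1) * real (min_degree G) - 2 * real \<alpha> - real \<beta> - 2"
proof -
  interpret connected_locally_finite_graph G
    using assms(1,2)
    by (simp add: connected_locally_finite_graph_def connected_locally_finite_graph_axioms_def)
  let ?N = "neighbors G"
  obtain W where W: "card W = connectivity G" "finite W" "disconnecting_set G W"
    using ex_minimum_disconnecting_set[OF assms(3)] by blast
  then obtain X Y where sep: "separation G W X Y" and WV: "W \<subseteq> pverts G"
    by (auto simp: disconnecting_set_iff)
  obtain w where w: "w \<in> W"
    using disconnecting_set_nonempty[OF W(3)] by blast
  obtain x where x: "x \<in> X" "adjacent G x w"
    using minimum_cut_neighbor[OF W(1,2) WV w sep] by blast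
  obtain y where y: "y \<in> Y" "adjacent G y w"
    using minimum_cut_neighbor[OF W(1,2) WV w separation_sym[OF sep]] by blast
  have XY: "X \<inter> Y = {}" "X \<union> Y = pverts G - W" "\<not> adjacent G x y"
    using sep x(1) y(1) by (auto simp: separation_def)
  note V = adjacent_in_pverts[OF x(2)] adjacent_in_pverts[OF y(2)]
  \<comment> \<open>\<open>a\<^sub>x\<close> and \<open>a\<^sub>y\<close> are the numerators over
    the degrees of \<open>x\<close> and \<open>y\<close> in the two curvature bounds.\<close>
  define a\<^sub>x where "a\<^sub>x = card (?N x \<inter> W - {w}) + card (?N x \<inter> ?N w \<inter> X) + 2"
  define a\<^sub>y where "a\<^sub>y = card (?N y \<inter> W - {w}) + card (?N y \<inter> ?N w \<inter> Y) + 2"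
  define m where "m = card (?N w \<inter> W)"

  have \<alpha>\<^sub>x: "card (?N x \<inter> ?N w \<inter> X) + card (?N x \<inter> ?N w \<inter> W) \<le> \<alpha>"
    by (rule order_trans[OF card_common_neighbors_ge assms(4)[OF x(2)]]) (use XY(2) in blast)
  have \<alpha>\<^sub>y: "card (?N y \<inter> ?N w \<inter> Y) + card (?N y \<inter> ?N w \<inter> W) \<le> \<alpha>"
    by (rule order_trans[OF card_common_neighbors_ge assms(4)[OF y(2)]]) (use XY(2) in blast)

  have "graph_dist G x y = 2"
    using graph_dist_eq_2[OF x(2) adjacent_sym[OF y(2)]] XY x(1) y(1) by blast
  then have "card (common_neighbors G x y) \<le> \<beta>"
    using assms(5) V by blast
  moreover have "card (?N x \<inter> ?N y \<inter> W) \<le> card (common_neighbors G x y)"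
    using finite_neighbors by (intro card_mono) (auto simp: common_neighbors_eq)
  ultimately have \<beta>: "card (?N x \<inter> ?N y \<inter> W) \<le> \<beta>" by simp
  have "w \<notin> ?N w" "w \<in> ?N x \<inter> ?N y"
    using adjacent_neq[of w w] x(2) y(2) by auto
  \<comment> \<open>\<open>a\<^sub>x\<close> and \<open>a\<^sub>y\<close> together carry the
    constant 4, of which \<open>card_cut_inequality\<close> absorbs 2. Each triple intersection in
    \<open>W\<close> joins the common neighbors outside \<open>W\<close> to make up one
    \<alpha>.\<close>
  then have count: "a\<^sub>x + a\<^sub>y + m \<le> connectivity G + \<beta> + 2 * \<alpha> + 2"
    using card_cut_inequality[OF W(2) w, of "?N w" "?N x" "?N y"] \<alpha>\<^sub>x \<alpha>\<^sub>y \<beta> W(1)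
    unfolding a\<^sub>x_def a\<^sub>y_def m_def by linarith

  \<comment> \<open>Combination of the two curvature bounds\<close>
  let ?d = "\<lambda>z. real (degree G z)"
  have deg: "?d x > 0" "?d y > 0" "?d w > 0"
    using degree_pos[OF x(2)] degree_pos[OF y(2)] degree_pos[OF adjacent_sym[OF x(2)]] by simp_all
  have "?N w = ?N w \<inter> X \<union> ?N w \<inter> Y \<union> ?N w \<inter> W"
    using XY(2) adjacent_in_pverts(2)[of w] by (auto simp: set_eq_iff)
  also have "card \<dots> = card (?N w \<inter> X \<union> ?N w \<inter> Y) + card (?N w \<inter> W)"
    using XY finite_neighbors by (intro card_Un_disjoint) auto
  also have "card (?N w \<inter> X \<union> ?N w \<inter> Y) = card (?N w \<inter> X) + card (?N w \<inter> Y)"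
    using XY finite_neighbors by (intro card_Un_disjoint) auto
  finally have deg_w: "degree G w = card (?N w \<inter> X) + card (?N w \<inter> Y) + m"
    by (simp add: degree_eq m_def)

  have "kappa_LLY_graph G \<le> real a\<^sub>x / ?d x - 1 + (real (card (?N w \<inter> X)) + real m) / ?d w"
    using kappa_LLY_graph_le[OF x(2)] kappa_LLY_cut_le[OF sep WV w x]
    by (simp add: a\<^sub>x_def m_def ac_simps)
  moreover have "kappa_LLY_graph G \<le> real a\<^sub>y / ?d y - 1 + (real (card (?N w \<inter> Y)) + real m) / ?d w"
    using kappa_LLY_graph_le[OF y(2)] kappa_LLY_cut_le[OF separation_sym[OF sep] WV w y]
    by (simp add: a\<^sub>y_def m_def ac_simps)
  \<comment> \<open>Each bound counts the neighbors of \<open>w\<close> in \<open>W\<close>, so they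
    exceed the degree of \<open>w\<close> by one extra \<open>m\<close>. The resulting 1 cancels one
    of the two -1 terms; the other becomes the +1 beside the curvature.\<close>
  moreover have "(real (card (?N w \<inter> X)) + real m) / ?d w + (real (card (?N w \<inter> Y)) + real m) / ?d w =
      (?d w + real m) / ?d w"
    by (simp add: deg_w add_divide_distrib)
  moreover have "(?d w + real m) / ?d w = 1 + real m / ?d w"
    using deg(3) by (simp add: add_divide_distrib)
  ultimately have "2 * kappa_LLY_graph G + 1 \<le> real a\<^sub>x / ?d x + real a\<^sub>y / ?d y + real m / ?d w"
    by simp
  \<comment> \<open>Multiplying by the nonnegative minimum degree is valid whatever the sign of the
    curvature term; afterwards each ratio of minimum degree to degree is at most 1.\<close>
  then have "(2 * kappa_LLY_graph G + 1) * real (min_degree G) \<le>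
      (real a\<^sub>x / ?d x + real a\<^sub>y / ?d y + real m / ?d w) * real (min_degree G)"
    by (rule mult_right_mono) simp
  also have "\<dots> = real a\<^sub>x * (real (min_degree G) / ?d x) + real a\<^sub>y * (real (min_degree G) / ?d y) +
      real m * (real (min_degree G) / ?d w)"
    by (simp add: algebra_simps)
  also have "\<dots> \<le> real a\<^sub>x * 1 + real a\<^sub>y * 1 + real m * 1"
    using deg min_degree_le[OF V(1)] min_degree_le[OF V(2)] min_degree_le[OF V(3)]
    by (intro add_mono mult_left_mono) simp_all
  also have "\<dots> \<le> real (connectivity G) + real \<beta> + 2 * real \<alpha> + 2"
    using count by linarith
  finally show ?thesis by simp
qed

end
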